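(* Let $1<p,q<\infty$ and $0<r<\infty$ satisfy $\frac1r=\frac1p+\frac1q$. Suppose that there is a constant $C$ such that for all real sequences $(a_n)_{n\in\mathbb Z}$, $(b_n)_{n\in\mathbb Z}$ with $a_n<b_n\le a_{n+1}$, $b_n-a_n=b_{n-1}-a_{n-1}$ and $a_{n+1}-b_n=a_n-b_{n-1}$ for all $n\in\mathbb Z$, and for all Schwartz functions $f,g\in\mathcal S(\mathbb R)$, $$ \left\| \left( \sum_{n\in \mathbb Z} \left|\pi_{[a_n,b_n]}(f,g) \right|^2 \right)^{1/2} \right\|_{L^r(\mathbb R)} \leq C \|f\|_{L^p(\mathbb R)} \|g\|_{L^q(\mathbb R)}.$$ Then $p\geq 2$ and $q\geq 2$.
   Context: For an interval $I\subset\mathbb R$, $\pi_I$ denotes the bilinear Fourier multiplier with symbol $\mathbf 1_I(\xi_2-\xi_1)$, defined for Schwartz functions $f,g$ on $\mathbb R$ by $$ \pi_I(f,g)(x):= \int_{\mathbb R^2} e^{ix(\xi_1+\xi_2)}\, \widehat{f}(\xi_1)\,\widehat{g}(\xi_2)\, \mathbf 1_I(\xi_2-\xi_1)\, d\xi_1\,d\xi_2 .$$ The Fourier transform is normalized with any fixed convention compatible with the exponentials $e^{ix\xi}$. For $r<1$, $\|\cdot\|_{L^r}$ is the usual quasi-norm. *)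

theory Defs
  imports "HOL-Analysis.Analysis"
begin

text \<open>The sequence \<open>D\<close> below is unique: \<open>D n\<close> is the \<open>n\<close>-th derivative of \<open>f\<close>.\<close>

definition schwartz :: "(real \<Rightarrow> complex) \<Rightarrow> bool" where
  "schwartz f \<longleftrightarrow>
     (\<exists>D :: nat \<Rightarrow> real \<Rightarrow> complex.
        D 0 = f \<and>
        (\<forall>n x. (D n has_vector_derivative D (Suc n) x) (at x)) \<and>
        (\<forall>k n. bounded (range (\<lambda>x. x ^ k *\<^sub>R D n x))))"

text \<open>The normalisation is the one for which Fourier inversion reads
  \<open>f x = (\<integral>\<xi>. exp (\<i> x \<xi>) * fourier f \<xi>)\<close>, so that the bilinear multiplier with symbol \<open>1\<close>
  is the pointwise product.\<close>

definition fourier :: "(real \<Rightarrow> complex) \<Rightarrow> real \<Rightarrow> complex" where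
  "fourier f \<xi> =
     complex_of_real (1 / (2 * pi)) *
       (\<integral>x. f x * exp (- \<i> * complex_of_real (x * \<xi>)) \<partial>lborel)"

definition bilinear_proj ::
    "real set \<Rightarrow> (real \<Rightarrow> complex) \<Rightarrow> (real \<Rightarrow> complex) \<Rightarrow> real \<Rightarrow> complex" where
  "bilinear_proj I f g x =
     (\<integral>\<xi>. exp (\<i> * complex_of_real (x * (fst \<xi> + snd \<xi>))) *
           fourier f (fst \<xi>) * fourier g (snd \<xi>) *
           indicator I (snd \<xi> - fst \<xi>)
       \<partial>(lborel :: (real \<times> real) measure))"

text \<open>Real powers on \<open>[0, \<infinity>]\<close>; the value at \<open>\<infinity>\<close> is the usual one only for exponents \<open>s > 0\<close>,
  which are the only ones used.\<close>

definition ennreal_powr :: "ennreal \<Rightarrow> real \<Rightarrow> ennreal" where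
  "ennreal_powr t s = (if t = \<infinity> then \<infinity> else ennreal (enn2real t powr s))"

text \<open>The \<open>L\<^sup>r\<close> (quasi-)norm of a nonnegative extended-valued function on the line; it is \<open>\<infinity>\<close> when
  the function does not lie in \<open>L\<^sup>r\<close>.\<close>

definition Lr_norm :: "real \<Rightarrow> (real \<Rightarrow> ennreal) \<Rightarrow> ennreal" where
  "Lr_norm r F = ennreal_powr (\<integral>\<^sup>+x. ennreal_powr (F x) r \<partial>lborel) (1 / r)"

definition square_function :: "(int \<Rightarrow> real \<Rightarrow> complex) \<Rightarrow> real \<Rightarrow> ennreal" where
  "square_function h x = ennreal_powr (\<Sum>\<^sub>\<infinity>n\<in>UNIV. ennreal ((cmod (h n x))\<^sup>2)) (1 / 2)"

end

theory Submission
  imports Defs "HOL-Probability.Characteristic_Functions" "HOL-Real_Asymp.Real_Asymp"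
begin

text \<open>The estimate is tested on two Gaussians of very different frequency scales, with the unit intervals
  \<open>[n, n + 1]\<close>. Let \<open>f x = exp (- (N x)\<^sup>2 / 2)\<close> and \<open>g x = exp (- x\<^sup>2 / 2)\<close>. Then \<open>fourier f\<close> has
  height comparable to \<open>1 / N\<close> on the frequency band of width \<open>N\<close>, while \<open>fourier g\<close> lives at
  frequencies of size \<open>1\<close>. For \<open>0 \<le> n < N\<close> the strip \<open>n \<le> \<xi>\<^sub>2 - \<xi>\<^sub>1 \<le> n + 1\<close> meets the region where
  \<open>fourier f \<xi>\<^sub>1 * fourier g \<xi>\<^sub>2\<close> is at least a constant times \<open>1 / N\<close> in a set of area bounded below.
  On the part of the strip that matters, \<open>\<xi>\<^sub>1 + \<xi>\<^sub>2\<close> differs from the constant \<open>- n\<close> only by a bounded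
  amount; so for \<open>x\<close> in a fixed neighbourhood of \<open>0\<close> the oscillating factor is
  \<open>exp (- \<i> x n)\<close> up to a small error, no cancellation takes place, and each of these \<open>N\<close> pieces has
  absolute value at least a constant times \<open>1 / N\<close> (lemma \<open>bilinear_proj_gauss_lower_bound\<close>).
  
  The square function is therefore at least of order \<open>N powr (- 1 / 2)\<close> on a fixed interval, and so is
  its \<open>L\<^sup>r\<close> quasi-norm. On the other side, \<open>f\<close> is a dilate of \<open>g\<close>, and its \<open>L\<^sup>p\<close> norm is of order
  \<open>N powr (- 1 / p)\<close> (lemma \<open>Lr_norm_gauss\<close>). Letting \<open>N\<close> tend to infinity forces
  \<open>1 / p \<le> 1 / 2\<close> (lemma \<open>exponent_ge_2\<close>).
  Exchanging \<open>f\<close> and \<open>g\<close> reflects the multiplier, \<open>[n, n + 1]\<close> becoming \<open>[- n - 1, - n]\<close>, which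
  merely permutes this family of intervals (lemma \<open>square_function_gauss_swap\<close>); the same argument then
  gives \<open>1 / q \<le> 1 / 2\<close>.\<close>

section \<open>Gaussian test functions\<close>

definition gauss :: "real \<Rightarrow> real \<Rightarrow> complex" where
  "gauss s x = complex_of_real (exp (- ((s * x)\<^sup>2) / 2))"

lemma nn_integral_gaussian:
  fixes c :: real
  assumes "c > 0"
  shows "(\<integral>\<^sup>+x. ennreal (exp (- c * x\<^sup>2)) \<partial>lborel) = ennreal (sqrt (pi / c))"
proof -
  define \<sigma> where "\<sigma> = sqrt (1 / (2 * c))"
  have \<sigma>: "\<sigma> > 0" "\<sigma>\<^sup>2 = 1 / (2 * c)"
    using assms by (auto simp: \<sigma>_def)
  have "exp (- c * x\<^sup>2) = sqrt (pi / c) * normal_density 0 \<sigma> x" for x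
    using assms by (simp add: normal_density_def \<sigma>)
  then have "(\<integral>\<^sup>+x. ennreal (exp (- c * x\<^sup>2)) \<partial>lborel) =
      ennreal (sqrt (pi / c)) * (\<integral>\<^sup>+x. ennreal (normal_density 0 \<sigma> x) \<partial>lborel)"
    using assms by (simp add: ennreal_mult nn_integral_cmult)
  also have "(\<integral>\<^sup>+x. ennreal (normal_density 0 \<sigma> x) \<partial>lborel) = 1"
    using \<sigma> by (subst nn_integral_eq_integral) auto
  finally show ?thesis by simp
qed

text \<open>After the substitution \<open>x \<mapsto> s x\<close> the integral is the characteristic function of the standard normal
  distribution.\<close>

lemma fourier_gauss:
  assumes "s > 0"
  shows "fourier (gauss s) \<xi> =
    complex_of_real (1 / (s * sqrt (2 * pi)) * exp (- ((\<xi> / s)\<^sup>2) / 2))"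
proof -
  have "char std_normal_distribution (- \<xi> / s) =
      (\<integral>x. complex_of_real (std_normal_density x) * exp (\<i> * complex_of_real (- \<xi> / s * x)) \<partial>lborel)"
    unfolding char_def by (subst integral_density) (auto simp: scaleR_conv_of_real)
  also have "\<dots> = complex_of_real s * (\<integral>x. complex_of_real (std_normal_density (s * x)) * exp (\<i> * complex_of_real (- \<xi> / s * (s * x))) \<partial>lborel)"
    using assms by (subst lborel_integral_real_affine[of s _ 0]) (auto simp: scaleR_conv_of_real)
  also have "(\<lambda>x. complex_of_real (std_normal_density (s * x)) * exp (\<i> * complex_of_real (- \<xi> / s * (s * x)))) =
     (\<lambda>x. complex_of_real (1 / sqrt (2 * pi)) * (gauss s x * exp (- \<i> * complex_of_real (x * \<xi>))))"
    using assms by (auto simp: fun_eq_iff std_normal_density_def gauss_def mult.commute)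
  finally have *: "complex_of_real (exp (- ((\<xi> / s)\<^sup>2) / 2)) =
     complex_of_real s * (complex_of_real (1 / sqrt (2 * pi)) * (\<integral>x. gauss s x * exp (- \<i> * complex_of_real (x * \<xi>)) \<partial>lborel))"
    by (simp add: char_std_normal_distribution)
  define J where "J = (\<integral>x. gauss s x * exp (- \<i> * complex_of_real (x * \<xi>)) \<partial>lborel)"
  have pp: "complex_of_real (2 * pi) = complex_of_real (sqrt (2 * pi)) * complex_of_real (sqrt (2 * pi))"
    by (simp flip: of_real_mult)
  have "fourier (gauss s) \<xi> = complex_of_real (1 / (s * sqrt (2 * pi))) * complex_of_real (exp (- ((\<xi> / s)\<^sup>2) / 2))"
    unfolding fourier_def * J_def[symmetric] of_real_divide pp using assms
    by (simp add: field_simps)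
  then show ?thesis by simp
qed

text \<open>Every derivative of a Gaussian is a polynomial times that Gaussian, and this form is preserved under
  multiplication by \<open>x ^ k\<close>; this bound thus covers all Schwartz seminorms at once.\<close>

lemma bounded_poly_times_gaussian:
  fixes P :: "real poly" and s :: real
  assumes "s > 0"
  shows "bounded (range (\<lambda>x. poly P x * exp (- ((s * x)\<^sup>2) / 2)))"
proof -
  have monomial: "bounded (range (\<lambda>x. x ^ k * exp (- ((s * x)\<^sup>2) / 2)))" for k
  proof -
    let ?h = "\<lambda>x::real. x ^ k * exp (- ((s * x)\<^sup>2) / 2)"
    have "(?h \<longlongrightarrow> 0) at_top" "(?h \<longlongrightarrow> 0) at_bot"
      using assms by real_asymp+
    then have "eventually (\<lambda>x. norm (?h x) < 1) at_top" "eventually (\<lambda>x. norm (?h x) < 1) at_bot"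
      by (auto dest: tendstoD[where e = 1] simp: dist_norm)
    then obtain A B where AB: "\<And>x. x \<ge> A \<Longrightarrow> norm (?h x) < 1" "\<And>x. x \<le> B \<Longrightarrow> norm (?h x) < 1"
      unfolding eventually_at_top_linorder eventually_at_bot_linorder by blast
    have "bounded (?h ` {B..A})"
      by (intro compact_imp_bounded compact_continuous_image continuous_intros) auto
    then obtain M where M: "\<And>x. x \<in> {B..A} \<Longrightarrow> norm (?h x) \<le> M"
      unfolding bounded_iff by blast
    have "norm (?h x) \<le> max M 1" for x
      using AB[of x] M[of x] by (cases "x \<ge> A"; cases "x \<le> B") (auto simp: max_def not_le)
    then show ?thesis unfolding bounded_iff by blast
  qed
  have "bounded (range (\<lambda>x. (\<Sum>i\<le>n. coeff P i * x ^ i) * exp (- ((s * x)\<^sup>2) / 2)))" for n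
  proof (induction n)
    case 0
    show ?case using bounded_scaleR_comp[OF monomial[of 0], of "coeff P 0"] by simp
  next
    case (Suc n)
    show ?case
      using bounded_plus_comp[OF Suc bounded_scaleR_comp[OF monomial[of "Suc n"], of "coeff P (Suc n)"]]
      by (simp add: algebra_simps)
  qed
  then show ?thesis unfolding poly_altdef .
qed

lemma schwartz_gauss:
  assumes "s > 0"
  shows "schwartz (gauss s)"
proof -
  \<comment> \<open>Differentiating \<open>Q x * exp (- (s x)\<^sup>2 / 2)\<close> replaces \<open>Q\<close> by \<open>Q' - s\<^sup>2 x Q\<close>.\<close>
  define P where "P n = ((\<lambda>Q. pderiv Q - [:0, s\<^sup>2:] * Q) ^^ n) [:1:]" for n
  define D where "D n x = complex_of_real (poly (P n) x * exp (- ((s * x)\<^sup>2) / 2))" for n x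
  have PSuc: "P (Suc n) = pderiv (P n) - [:0, s\<^sup>2:] * P n" for n
    by (simp add: P_def)
  have "D 0 = gauss s"
    by (simp add: fun_eq_iff D_def P_def gauss_def)
  moreover have "(D n has_vector_derivative D (Suc n) x) (at x)" for n x
  proof -
    have "((\<lambda>x. poly (P n) x * exp (- ((s * x)\<^sup>2) / 2)) has_real_derivative
        poly (P (Suc n)) x * exp (- ((s * x)\<^sup>2) / 2)) (at x)"
      unfolding PSuc
      by (rule derivative_eq_intros poly_DERIV refl | simp)+
         (simp add: algebra_simps power2_eq_square)
    from has_vector_derivative_of_real[OF this]
    show ?thesis unfolding D_def .
  qed
  moreover have "bounded (range (\<lambda>x. x ^ k *\<^sub>R D n x))" for k n
  proof -
    have "norm (x ^ k *\<^sub>R D n x) = norm (poly (monom 1 k * P n) x * exp (- ((s * x)\<^sup>2) / 2))" for x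
      by (simp add: D_def norm_mult poly_monom power_abs abs_mult)
    then show ?thesis
      using bounded_poly_times_gaussian[OF assms, of "monom 1 k * P n"]
      unfolding bounded_iff by auto
  qed
  ultimately show ?thesis unfolding schwartz_def by blast
qed

lemma Lr_norm_gauss:
  assumes "p > 0" "s > 0"
  shows "Lr_norm p (\<lambda>x. ennreal (cmod (gauss s x))) =
    ennreal (((sqrt (2 * pi / p)) / s) powr (1 / p))"
proof -
  have "ennreal_powr (ennreal (cmod (gauss s x))) p = ennreal (exp (- (p * s\<^sup>2 / 2) * x\<^sup>2))" for x
    using assms by (simp add: ennreal_powr_def gauss_def powr_def power_mult_distrib)
  moreover have "sqrt (pi / (p * s\<^sup>2 / 2)) = sqrt (2 * pi / p) / s"
    using assms by (simp add: real_sqrt_divide real_sqrt_mult)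
  ultimately have "(\<integral>\<^sup>+x. ennreal_powr (ennreal (cmod (gauss s x))) p \<partial>lborel) = ennreal (sqrt (2 * pi / p) / s)"
    using nn_integral_gaussian[of "p * s\<^sup>2 / 2"] assms by simp
  then show ?thesis using assms by (simp add: Lr_norm_def ennreal_powr_def)
qed

section \<open>Lower bounds for the norm and the square function\<close>

lemma ennreal_powr_mono:
  assumes "0 < s" "t \<le> u"
  shows "ennreal_powr t s \<le> ennreal_powr u s"
proof (cases "u = \<infinity>")
  case False
  then have "t \<noteq> \<infinity>" "enn2real t \<le> enn2real u"
    using assms by (auto simp: top.extremum_unique less_top intro: enn2real_mono)
  then show ?thesis
    using False assms by (simp add: ennreal_powr_def ennreal_leI powr_mono2)
qed (simp add: ennreal_powr_def)

lemma square_function_ge: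
  assumes "\<And>n. n \<in> {0..<int N} \<Longrightarrow> c \<le> cmod (h n x)" and "0 \<le> c"
  shows "ennreal (c * sqrt N) \<le> square_function h x"
proof -
  have "ennreal (real N * c\<^sup>2) = (\<Sum>n\<in>{0..<int N}. ennreal (c\<^sup>2))"
    by (simp add: ennreal_mult ennreal_of_nat_eq_real_of_nat)
  also have "\<dots> \<le> (\<Sum>n\<in>{0..<int N}. ennreal ((cmod (h n x))\<^sup>2))"
    using assms by (intro sum_mono ennreal_leI power_mono) auto
  also have "\<dots> \<le> (\<Sum>\<^sub>\<infinity>n\<in>UNIV. ennreal ((cmod (h n x))\<^sup>2))"
    by (subst nonneg_infsum_complete) (auto intro!: SUP_upper)
  finally have "ennreal_powr (ennreal (real N * c\<^sup>2)) (1/2) \<le> square_function h x"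
    unfolding square_function_def by (rule ennreal_powr_mono[rotated]) simp
  moreover have "ennreal_powr (ennreal (real N * c\<^sup>2)) (1/2) = ennreal (c * sqrt N)"
    using assms(2) by (simp add: ennreal_powr_def powr_half_sqrt real_sqrt_mult mult.commute)
  ultimately show ?thesis by simp
qed

lemma Lr_norm_ge:
  assumes "r > 0" "\<delta> > 0" "c \<ge> 0" and F: "\<And>x. \<bar>x\<bar> \<le> \<delta> \<Longrightarrow> ennreal c \<le> F x"
  shows "ennreal ((2 * \<delta>) powr (1 / r) * c) \<le> Lr_norm r F"
proof -
  have "ennreal (c powr r) * indicator {- \<delta>..\<delta>} x \<le> ennreal_powr (F x) r" for x
    using ennreal_powr_mono[OF assms(1) F[of x]] assms(3)
    by (auto simp: indicator_def ennreal_powr_def abs_le_iff)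
  then have "(\<integral>\<^sup>+x. ennreal (c powr r) * indicator {- \<delta>..\<delta>} x \<partial>lborel) \<le> (\<integral>\<^sup>+x. ennreal_powr (F x) r \<partial>lborel)"
    by (intro nn_integral_mono)
  also have "(\<integral>\<^sup>+x. ennreal (c powr r) * indicator {- \<delta>..\<delta>} x \<partial>lborel) = ennreal (2 * \<delta> * c powr r)"
    using assms by (simp add: nn_integral_cmult ennreal_mult mult.commute)
  finally have "ennreal_powr (ennreal (2 * \<delta> * c powr r)) (1 / r) \<le> Lr_norm r F"
    unfolding Lr_norm_def using assms(1) by (intro ennreal_powr_mono) auto
  then show ?thesis
    using assms by (simp add: ennreal_powr_def powr_mult powr_powr)
qed

section \<open>A single multiplier on Gaussians\<close>

lemma cos_ge_quadratic: "1 - y\<^sup>2 / 2 \<le> cos (y::real)"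
proof -
  have "(sin (y / 2))\<^sup>2 \<le> (y / 2)\<^sup>2"
    using abs_sin_x_le_abs_x[of "y / 2"] by (simp only: abs_le_square_iff)
  then show ?thesis using cos_double_sin[of "y / 2"] by (simp add: power_divide)
qed

text \<open>For each fixed value of the second coordinate, the strip is an interval of length \<open>b - a\<close> in the
  first one. Its use is to bound a weight depending on \<open>\<xi>\<^sub>2\<close> alone uniformly over the position of
  the strip.\<close>

lemma nn_integral_strip:
  fixes G :: "real \<Rightarrow> ennreal"
  assumes [measurable]: "G \<in> borel_measurable borel" and "a \<le> b"
  shows "(\<integral>\<^sup>+\<xi>. G (snd \<xi>) * indicator {a..b} (snd \<xi> - fst \<xi>) \<partial>(lborel :: (real \<times> real) measure))
    = ennreal (b - a) * (\<integral>\<^sup>+y. G y \<partial>lborel)"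
proof -
  have "(\<integral>\<^sup>+\<xi>. G (snd \<xi>) * indicator {a..b} (snd \<xi> - fst \<xi>) \<partial>(lborel :: (real \<times> real) measure))
     = (\<integral>\<^sup>+y. (\<integral>\<^sup>+x. G y * indicator {a..b} (y - x) \<partial>lborel) \<partial>lborel)"
    unfolding lborel_prod[symmetric] by (subst lborel_pair.nn_integral_snd[symmetric]) auto
  also have "\<dots> = (\<integral>\<^sup>+y. G y * (\<integral>\<^sup>+x. indicator {y - b..y - a} x \<partial>lborel) \<partial>lborel)"
    by (subst nn_integral_cmult[symmetric], simp) 
       (auto intro!: nn_integral_cong simp: indicator_def)
  also have "\<dots> = ennreal (b - a) * (\<integral>\<^sup>+y. G y \<partial>lborel)"
    using assms(2) by (simp add: nn_integral_multc mult.commute)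
  finally show ?thesis .
qed

text \<open>Up to the constant \<open>1 / (2 * pi * s)\<close>, the multiplier is the integral of \<open>exp (\<i> x (\<xi>\<^sub>1 + \<xi>\<^sub>2))\<close> against a
  nonnegative Gaussian weight \<open>E\<close> on the strip. Multiplying by the unimodular constant \<open>exp (\<i> x n)\<close>
  replaces the phase by \<open>x y\<close> with \<open>y = \<xi>\<^sub>1 + \<xi>\<^sub>2 + n\<close>. On the strip \<open>\<xi>\<^sub>2 - \<xi>\<^sub>1 - n\<close> lies in \<open>[0, 1]\<close>,
  whence \<open>y\<^sup>2 \<le> 2 * (4 * \<xi>\<^sub>2\<^sup>2 + 1)\<close>. As \<open>cos (x y) \<ge> 1 - (x y)\<^sup>2 / 2\<close>, the loss compared with the
  total mass of \<open>E\<close> is at most \<open>x\<^sup>2\<close> times the integral of \<open>(4 * \<xi>\<^sub>2\<^sup>2 + 1) * E\<close>. The latter is bounded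
  uniformly in \<open>n\<close> and \<open>s\<close> through the majorant \<open>H\<close>, whose integral is \<open>32 * sqrt pi\<close>, while the mass
  of \<open>E\<close> is at least \<open>exp (- 1) / 4\<close>. The smallness assumption on \<open>x\<close> makes the loss at most half
  of this.\<close>

lemma bilinear_proj_gauss_lower_bound:
  fixes x s n :: real
  assumes n: "0 \<le> n" "n + 1 \<le> s" and x: "x\<^sup>2 * (32 * sqrt pi) \<le> exp (- 1) / 8"
  shows "exp (- 1) / (16 * pi) / s \<le> cmod (bilinear_proj {n..n + 1} (gauss s) (gauss 1) x)"
proof -
  have s: "s > 0" using n by simp
  define S :: "real \<times> real \<Rightarrow> real" where "S \<xi> = indicator {n..n + 1} (snd \<xi> - fst \<xi>)" for \<xi>
  define E where "E \<xi> = exp (- ((fst \<xi> / s)\<^sup>2) / 2) * exp (- ((snd \<xi>)\<^sup>2) / 2) * S \<xi>" for \<xi>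
  define H where "H \<xi> = 16 * exp (- (1/4) * (snd \<xi>)\<^sup>2) * S \<xi>" for \<xi>
  define F where "F \<xi> = exp (\<i> * complex_of_real (x * (fst \<xi> + snd \<xi>))) * complex_of_real (E \<xi>)" for \<xi> :: "real \<times> real"
  define c where "c = cis (x * n)"
  have [measurable]: "S \<in> borel_measurable borel" "E \<in> borel_measurable borel"
     "H \<in> borel_measurable borel" "F \<in> borel_measurable borel"
    unfolding S_def[abs_def] E_def[abs_def] H_def[abs_def] F_def[abs_def]
      borel_prod[symmetric] by measurable
  have S01: "S \<xi> \<ge> 0" "S \<xi> \<le> 1" for \<xi> by (auto simp: S_def)
  have E0: "E \<xi> \<ge> 0" and H0: "H \<xi> \<ge> 0" for \<xi> using S01 by (auto simp: E_def H_def)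

  have "(\<integral>\<^sup>+\<xi>. ennreal (H \<xi>) \<partial>lborel) = (\<integral>\<^sup>+\<xi>. ennreal (16 * exp (- (1/4) * (snd \<xi>)\<^sup>2)) *
      indicator {n..n + 1} (snd \<xi> - fst \<xi>) \<partial>(lborel :: (real \<times> real) measure))"
    by (intro nn_integral_cong) (auto simp: H_def S_def indicator_def)
  also have "\<dots> = (\<integral>\<^sup>+y. ennreal (16 * exp (- (1/4) * y\<^sup>2)) \<partial>lborel)"
    by (subst nn_integral_strip) auto
  also have "\<dots> = ennreal 16 * (\<integral>\<^sup>+y. ennreal (exp (- (1/4) * y\<^sup>2)) \<partial>lborel)"
    by (subst nn_integral_cmult[symmetric]) (auto simp: ennreal_mult)
  also have "\<dots> = ennreal 16 * ennreal (sqrt (pi / (1/4)))"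
    by (subst nn_integral_gaussian) auto
  also have "\<dots> = ennreal (32 * sqrt pi)"
    by (subst ennreal_mult[symmetric]) (auto simp: real_sqrt_mult)
  finally have nnH: "(\<integral>\<^sup>+\<xi>. ennreal (H \<xi>) \<partial>lborel) = ennreal (32 * sqrt pi)" .
  have iH: "integrable lborel H"
    using H0 nnH by (intro integrableI_nonneg) auto
  have intH: "integral\<^sup>L lborel H = 32 * sqrt pi"
    using H0 nnH by (subst integral_eq_nn_integral) auto

  \<comment> \<open>One half of the exponent of the Gaussian is spent on absorbing the quadratic factor, and what is
     left is the majorant \<open>H\<close>.\<close>
  have moment: "(4 * y\<^sup>2 + 1) * exp (- (y\<^sup>2) / 2) \<le> 16 * exp (- (1/4) * y\<^sup>2)" for y :: real
  proof -
    have "4 * y\<^sup>2 + 1 \<le> 16 * exp (y\<^sup>2 / 4)"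
      using exp_ge_add_one_self[of "y\<^sup>2 / 4"] by linarith
    then have "(4 * y\<^sup>2 + 1) * exp (- (y\<^sup>2) / 2) \<le> 16 * exp (y\<^sup>2 / 4) * exp (- (y\<^sup>2) / 2)"
      by (intro mult_right_mono) auto
    also have "\<dots> = 16 * exp (- (1/4) * y\<^sup>2)"
      by (simp add: mult.assoc flip: exp_add)
    finally show ?thesis .
  qed
  have EH: "(4 * (snd \<xi>)\<^sup>2 + 1) * E \<xi> \<le> H \<xi>" for \<xi>
  proof -
    have "(4 * (snd \<xi>)\<^sup>2 + 1) * E \<xi> =
      exp (- ((fst \<xi> / s)\<^sup>2) / 2) * ((4 * (snd \<xi>)\<^sup>2 + 1) * exp (- ((snd \<xi>)\<^sup>2) / 2)) * S \<xi>"
      by (simp add: E_def)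
    also have "\<dots> \<le> 1 * (16 * exp (- (1/4) * (snd \<xi>)\<^sup>2)) * S \<xi>"
      using S01 by (intro mult_right_mono[OF mult_mono[OF _ moment]]) auto
    finally show ?thesis by (simp add: H_def)
  qed
  have "E \<xi> \<le> H \<xi>" for \<xi>
    using mult_right_mono[of 1 "4 * (snd \<xi>)\<^sup>2 + 1" "E \<xi>"] EH[of \<xi>] E0[of \<xi>] by simp
  then have iE: "integrable lborel E"
    by (intro Bochner_Integration.integrable_bound[OF iH]) (use E0 H0 in auto)
  have iF: "integrable lborel F"
    by (rule Bochner_Integration.integrable_bound[OF iE]) (use E0 in \<open>auto simp: F_def norm_mult\<close>)

  have intE: "exp (- 1) / 4 \<le> integral\<^sup>L lborel E"
  proof -
    \<comment> \<open>A square of side \<open>1/2\<close> inside the strip on which both \<open>\<bar>\<xi>\<^sub>1 / s\<bar>\<close> and \<open>\<bar>\<xi>\<^sub>2\<bar>\<close> are at most \<open>1\<close>.\<close>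
    let ?Q = "cbox (- n - 1/2, 0) (- n, 1/2) :: (real \<times> real) set"
    have "exp (- 1) * indicator ?Q \<xi> \<le> E \<xi>" for \<xi>
    proof (cases "\<xi> \<in> ?Q")
      case True
      then have a: "- n - 1/2 \<le> fst \<xi>" "fst \<xi> \<le> - n" "0 \<le> snd \<xi>" "snd \<xi> \<le> 1/2"
        by (cases \<xi>; auto simp: cbox_Pair_eq)+
      have "\<bar>fst \<xi> / s\<bar> \<le> 1" "\<bar>snd \<xi>\<bar> \<le> 1" using a n s by (auto simp: field_simps abs_if)
      then have "(fst \<xi> / s)\<^sup>2 \<le> 1" "(snd \<xi>)\<^sup>2 \<le> 1"
        by (auto simp: abs_square_le_1)
      then have "exp (- 1) \<le> exp (- ((fst \<xi> / s)\<^sup>2) / 2) * exp (- ((snd \<xi>)\<^sup>2) / 2)"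
        by (simp flip: exp_add)
      moreover have "S \<xi> = 1" using a by (simp add: S_def)
      ultimately show ?thesis using True by (simp add: E_def)
    qed (simp add: E0)
    moreover have "integrable lborel (indicator ?Q :: _ \<Rightarrow> real)"
      by (intro integrable_real_indicator) (auto simp: emeasure_lborel_cbox_eq)
    ultimately have "(\<integral>\<xi>. exp (- 1) * indicator ?Q \<xi> \<partial>lborel) \<le> integral\<^sup>L lborel E"
      by (intro integral_mono iE integrable_mult_right) auto
    moreover have "measure lborel ?Q = 1 / 4"
      by (simp add: content_Pair)
    ultimately show ?thesis by simp
  qed

  have "exp (- 1) / 8 \<le> integral\<^sup>L lborel E - x\<^sup>2 * integral\<^sup>L lborel H"
    using intE x by (simp add: intH)
  also have "\<dots> = (\<integral>\<xi>. E \<xi> - x\<^sup>2 * H \<xi> \<partial>lborel)"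
    using iE iH by simp
  also have "\<dots> \<le> (\<integral>\<xi>. Re (c * F \<xi>) \<partial>lborel)"
  proof (intro integral_mono)
    fix \<xi> :: "real \<times> real"
    define y where "y = fst \<xi> + snd \<xi> + n"
    have "c * F \<xi> = cis (x * y) * complex_of_real (E \<xi>)"
      by (simp add: c_def F_def y_def cis_conv_exp algebra_simps flip: exp_add)
    then have Re: "Re (c * F \<xi>) = cos (x * y) * E \<xi>" by simp
    show "E \<xi> - x\<^sup>2 * H \<xi> \<le> Re (c * F \<xi>)"
    proof (cases "n \<le> snd \<xi> - fst \<xi> \<and> snd \<xi> - fst \<xi> \<le> n + 1")
      case True
      \<comment> \<open>Here \<open>(u - v)\<^sup>2 \<le> 2 * (u\<^sup>2 + v\<^sup>2)\<close> separates \<open>2 * \<xi>\<^sub>2\<close> from the bounded part of the phase.\<close>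
      have "y\<^sup>2 = (2 * snd \<xi> - (snd \<xi> - fst \<xi> - n))\<^sup>2"
        by (simp add: y_def add_ac)
      also have "\<dots> \<le> 2 * ((2 * snd \<xi>)\<^sup>2 + (snd \<xi> - fst \<xi> - n)\<^sup>2)"
        using sum_squares_bound[of "2 * snd \<xi>" "- (snd \<xi> - fst \<xi> - n)"]
        by (simp add: power2_eq_square algebra_simps)
      also have "\<dots> \<le> 2 * ((2 * snd \<xi>)\<^sup>2 + 1)"
        using True by (simp add: power_le_one)
      finally have y: "y\<^sup>2 \<le> 2 * (4 * (snd \<xi>)\<^sup>2 + 1)" by (simp add: power_mult_distrib)
      have "E \<xi> - x\<^sup>2 * H \<xi> \<le> E \<xi> - x\<^sup>2 * ((4 * (snd \<xi>)\<^sup>2 + 1) * E \<xi>)"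
        using EH by (intro diff_left_mono mult_left_mono) auto
      also have "\<dots> = (1 - x\<^sup>2 * (4 * (snd \<xi>)\<^sup>2 + 1)) * E \<xi>"
        by (simp add: algebra_simps)
      also have "\<dots> \<le> (1 - (x * y)\<^sup>2 / 2) * E \<xi>"
        using mult_left_mono[OF y, of "x\<^sup>2"] E0
        by (intro mult_right_mono) (auto simp: power_mult_distrib algebra_simps)
      also have "\<dots> \<le> cos (x * y) * E \<xi>"
        using cos_ge_quadratic E0 by (intro mult_right_mono)
      finally show ?thesis unfolding Re .
    next
      case False
      then have "S \<xi> = 0" by (auto simp: S_def)
      then show ?thesis unfolding Re by (simp add: E_def H_def)
    qed
  qed (use iE iH in simp, intro integrable_Re integrable_mult_right iF)
  also have "\<dots> = Re (c * integral\<^sup>L lborel F)"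
    by (subst integral_Re) (use iF in simp_all)
  also have "\<dots> \<le> cmod (integral\<^sup>L lborel F)"
    using complex_Re_le_cmod[of "c * integral\<^sup>L lborel F"] by (simp add: norm_mult c_def)
  finally have main: "exp (- 1) / 8 \<le> cmod (integral\<^sup>L lborel F)" .

  have "bilinear_proj {n..n + 1} (gauss s) (gauss 1) x = complex_of_real (1 / (2 * pi * s)) * integral\<^sup>L lborel F"
  proof -
    have "exp (\<i> * complex_of_real (x * (fst \<xi> + snd \<xi>))) * fourier (gauss s) (fst \<xi>) *
        fourier (gauss 1) (snd \<xi>) * indicator {n..n + 1} (snd \<xi> - fst \<xi>) =
        complex_of_real (1 / (2 * pi * s)) * F \<xi>" for \<xi> :: "real \<times> real"
    proof -
      have "1 / (s * sqrt (2 * pi)) * (1 / sqrt (2 * pi)) = 1 / (2 * pi * s)"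
        using s by simp
      then have "1 / (s * sqrt (2 * pi)) * exp (- ((fst \<xi> / s)\<^sup>2) / 2) *
           (1 / (1 * sqrt (2 * pi)) * exp (- ((snd \<xi> / 1)\<^sup>2) / 2)) * S \<xi> = 1 / (2 * pi * s) * E \<xi>"
        unfolding E_def by (simp add: field_simps)
      then have "fourier (gauss s) (fst \<xi>) * fourier (gauss 1) (snd \<xi>) * complex_of_real (S \<xi>) =
          complex_of_real (1 / (2 * pi * s)) * complex_of_real (E \<xi>)"
        unfolding fourier_gauss[OF s] fourier_gauss[OF zero_less_one] of_real_mult[symmetric] by (rule arg_cong)
      moreover have "(indicator {n..n + 1} (snd \<xi> - fst \<xi>) :: complex) = complex_of_real (S \<xi>)"
        by (simp add: S_def indicator_def)
      ultimately show ?thesis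
        unfolding F_def by (simp only: mult.assoc mult.left_commute[of _ "exp _"])
    qed
    then show ?thesis unfolding bilinear_proj_def by simp
  qed
  then have "cmod (bilinear_proj {n..n + 1} (gauss s) (gauss 1) x) = cmod (integral\<^sup>L lborel F) / (2 * pi * s)"
    using s by (simp add: norm_mult norm_divide)
  moreover have "exp (- 1) / 8 / (2 * pi * s) \<le> cmod (integral\<^sup>L lborel F) / (2 * pi * s)"
    using main s by (intro divide_right_mono) auto
  ultimately show ?thesis by simp
qed

section \<open>Exchanging the two functions\<close>

text \<open>Exchanging the frequency variables turns \<open>\<xi>\<^sub>2 - \<xi>\<^sub>1\<close> into its negative and leaves \<open>\<xi>\<^sub>1 + \<xi>\<^sub>2\<close> alone.\<close>

lemma bilinear_proj_swap:
  assumes [measurable]: "fourier f \<in> borel_measurable borel" "fourier g \<in> borel_measurable borel"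
    and [measurable]: "I \<in> sets borel"
  shows "bilinear_proj I f g x = bilinear_proj (uminus ` I) g f x"
proof -
  let ?h = "\<lambda>\<xi>::real \<times> real. exp (\<i> * complex_of_real (x * (fst \<xi> + snd \<xi>))) *
           fourier f (fst \<xi>) * fourier g (snd \<xi>) * indicator I (snd \<xi> - fst \<xi>) :: complex"
  have "bilinear_proj I f g x = integral\<^sup>L (lborel \<Otimes>\<^sub>M lborel) ?h"
    unfolding bilinear_proj_def lborel_prod ..
  also have "\<dots> = (\<integral>(\<xi>, \<eta>). ?h (\<eta>, \<xi>) \<partial>(lborel \<Otimes>\<^sub>M lborel))"
    by (rule lborel_pair.integral_product_swap[symmetric]) measurable
  also have "\<dots> = bilinear_proj (uminus ` I) g f x"
  proof -
    have "y \<in> uminus ` I \<longleftrightarrow> - y \<in> I" for y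
      by force
    then have "indicator (uminus ` I) (\<eta> - \<xi>) = (indicator I (\<xi> - \<eta>) :: complex)" for \<xi> \<eta>
      by (simp add: indicator_def)
    then show ?thesis
      unfolding bilinear_proj_def lborel_prod by (simp add: case_prod_unfold add.commute mult_ac)
  qed
  finally show ?thesis .
qed

lemma measurable_fourier_gauss [measurable]:
  assumes "s > 0"
  shows "fourier (gauss s) \<in> borel_measurable borel"
  unfolding fourier_gauss[OF assms, abs_def] by measurable

text \<open>Reflection maps \<open>[n, n + 1]\<close> to \<open>[m, m + 1]\<close> with \<open>m = - 1 - n\<close>, so the two square functions sum the
  same terms in a different order.\<close>

lemma square_function_gauss_swap:
  assumes "s > 0" "t > 0"
  shows "square_function (\<lambda>n. bilinear_proj {of_int n..of_int n + 1} (gauss s) (gauss t)) =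
         square_function (\<lambda>n. bilinear_proj {of_int n..of_int n + 1} (gauss t) (gauss s))"
proof
  fix x
  let ?b = "\<lambda>f g n. ennreal ((cmod (bilinear_proj {of_int n..of_int n + 1} f g x))\<^sup>2)"
  have "?b (gauss s) (gauss t) n = ?b (gauss t) (gauss s) (- 1 - n)" for n :: int
    using assms by (subst bilinear_proj_swap) auto
  moreover have "bij_betw (\<lambda>n::int. - 1 - n) UNIV UNIV"
    by (rule bij_betwI[where g = "\<lambda>n. - 1 - n"]) auto
  ultimately have "infsum (?b (gauss s) (gauss t)) UNIV = infsum (?b (gauss t) (gauss s)) UNIV"
    using infsum_reindex_bij_betw[of "\<lambda>n::int. - 1 - n" UNIV UNIV "?b (gauss t) (gauss s)"] by simp
  then show "square_function (\<lambda>n. bilinear_proj {of_int n..of_int n + 1} (gauss s) (gauss t)) x =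
         square_function (\<lambda>n. bilinear_proj {of_int n..of_int n + 1} (gauss t) (gauss s)) x"
    by (simp add: square_function_def)
qed

section \<open>Necessity of the exponent conditions\<close>

text \<open>For \<open>p < 2\<close> the two sides, of order \<open>N powr (- 1 / 2)\<close> and \<open>N powr (- 1 / p)\<close>, would be incompatible for
  large \<open>N\<close>.\<close>

lemma exponent_ge_2:
  fixes p q r C :: real
  assumes "0 < p" "0 < q" "0 < r" "0 \<le> C"
    and bound: "\<And>s. s > 0 \<Longrightarrow>
        Lr_norm r (square_function (\<lambda>n. bilinear_proj {of_int n..of_int n + 1} (gauss s) (gauss 1)))
          \<le> ennreal C * Lr_norm p (\<lambda>x. ennreal (cmod (gauss s x)))
                      * Lr_norm q (\<lambda>x. ennreal (cmod (gauss 1 x)))"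
  shows "p \<ge> 2"
proof (rule ccontr)
  assume "\<not> p \<ge> 2"
  \<comment> \<open>The largest \<open>\<delta>\<close> for which \<open>bilinear_proj_gauss_lower_bound\<close> applies on all of \<open>[- \<delta>, \<delta>]\<close>.\<close>
  define \<delta> where "\<delta> = sqrt (exp (- 1) / 8 / (32 * sqrt pi))"
  have \<delta>: "\<delta> > 0" by (simp add: \<delta>_def)
  define K where "K = (2 * \<delta>) powr (1 / r) * (exp (- 1) / (16 * pi))"
  define L where "L = C * sqrt (2 * pi / p) powr (1 / p) * sqrt (2 * pi / q) powr (1 / q)"
  have K: "K > 0" using \<delta> by (simp add: K_def)
  have le: "K * real N powr (1 / p - 1 / 2) \<le> L" if N: "N > 0" for N :: nat
  proof -
    define c where "c = exp (- 1) / (16 * pi) / real N"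
    have "ennreal (c * sqrt N) \<le>
      square_function (\<lambda>n. bilinear_proj {of_int n..of_int n + 1} (gauss N) (gauss 1)) x"
      if x: "\<bar>x\<bar> \<le> \<delta>" for x
    proof (rule square_function_ge)
      have "x\<^sup>2 \<le> \<delta>\<^sup>2" using x by (simp add: abs_le_square_iff[symmetric])
      also have "\<dots> = exp (- 1) / 8 / (32 * sqrt pi)"
        unfolding \<delta>_def by (rule real_sqrt_pow2) simp
      finally have "x\<^sup>2 * (32 * sqrt pi) \<le> exp (- 1) / 8"
        by (simp add: field_simps)
      then show "c \<le> cmod (bilinear_proj {of_int n..of_int n + 1} (gauss N) (gauss 1) x)"
        if "n \<in> {0..<int N}" for n
        using that unfolding c_def by (intro bilinear_proj_gauss_lower_bound) auto
    qed (simp add: c_def)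
    then have "ennreal ((2 * \<delta>) powr (1 / r) * (c * sqrt N)) \<le>
       Lr_norm r (square_function (\<lambda>n. bilinear_proj {of_int n..of_int n + 1} (gauss N) (gauss 1)))"
      using \<delta> assms by (intro Lr_norm_ge) (auto simp: c_def)
    also have "\<dots> \<le> ennreal C * Lr_norm p (\<lambda>x. ennreal (cmod (gauss N x)))
                      * Lr_norm q (\<lambda>x. ennreal (cmod (gauss 1 x)))"
      using bound[of "real N"] N by simp
    also have "\<dots> = ennreal (L * real N powr (- 1 / p))"
      using N assms unfolding L_def
      by (simp add: Lr_norm_gauss powr_divide powr_minus field_simps flip: ennreal_mult)
    finally have "(2 * \<delta>) powr (1 / r) * (c * sqrt N) \<le> L * real N powr (- 1 / p)"
      using assms by (subst (asm) ennreal_le_iff) (auto simp: L_def)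
    also have "(2 * \<delta>) powr (1 / r) * (c * sqrt N) = K * real N powr (- 1 / 2)"
      using N by (simp add: K_def c_def powr_minus powr_half_sqrt real_div_sqrt field_simps)
    finally have "K * real N powr (- 1 / 2) * real N powr (1 / p) \<le> L * real N powr (- 1 / p) * real N powr (1 / p)"
      by (intro mult_right_mono) auto
    then show ?thesis
      using N by (simp add: mult.assoc flip: powr_add)
  qed
  have "1 / p - 1 / 2 > 0"
    using \<open>\<not> p \<ge> 2\<close> assms by (simp add: field_simps)
  then have "filterlim (\<lambda>N::nat. K * real N powr (1 / p - 1 / 2)) at_top sequentially"
    using K by real_asymp
  then have "eventually (\<lambda>N::nat. K * real N powr (1 / p - 1 / 2) > L) sequentially"
    by (simp add: filterlim_at_top_dense)
  then have "eventually (\<lambda>N::nat. N > 0 \<and> K * real N powr (1 / p - 1 / 2) > L) sequentially"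
    using eventually_gt_at_top[of "0::nat"] by (rule eventually_conj[rotated])
  then obtain N :: nat where "N > 0" "K * real N powr (1 / p - 1 / 2) > L"
    by (auto simp: eventually_sequentially)
  with le[of N] show False by linarith
qed

theorem proposition2p24:
  fixes p q r :: real
  assumes "1 < p" and "1 < q" and "0 < r"
    and "1 / r = 1 / p + 1 / q"
    and "\<exists>C::real. 0 \<le> C \<and>
      (\<forall>(a :: int \<Rightarrow> real) (b :: int \<Rightarrow> real) (f :: real \<Rightarrow> complex) (g :: real \<Rightarrow> complex).
        (\<forall>n. a n < b n \<and> b n \<le> a (n + 1) \<and>
             b n - a n = b (n - 1) - a (n - 1) \<and>
             a (n + 1) - b n = a n - b (n - 1)) \<longrightarrow>
        schwartz f \<longrightarrow> schwartz g \<longrightarrow>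
        Lr_norm r (square_function (\<lambda>n. bilinear_proj {a n..b n} f g))
          \<le> ennreal C * Lr_norm p (\<lambda>x. ennreal (cmod (f x)))
                      * Lr_norm q (\<lambda>x. ennreal (cmod (g x))))"
  shows "p \<ge> 2 \<and> q \<ge> 2"
proof -
  obtain C where C: "0 \<le> C" and all: "\<And>(a :: int \<Rightarrow> real) b f g.
       (\<forall>n. a n < b n \<and> b n \<le> a (n + 1) \<and>
             b n - a n = b (n - 1) - a (n - 1) \<and>
             a (n + 1) - b n = a n - b (n - 1)) \<Longrightarrow>
        schwartz f \<Longrightarrow> schwartz g \<Longrightarrow>
        Lr_norm r (square_function (\<lambda>n. bilinear_proj {a n..b n} f g))
          \<le> ennreal C * Lr_norm p (\<lambda>x. ennreal (cmod (f x)))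
                      * Lr_norm q (\<lambda>x. ennreal (cmod (g x)))"
    using assms(5) by blast
  have bound: "Lr_norm r (square_function (\<lambda>n. bilinear_proj {of_int n..of_int n + 1} (gauss s) (gauss t)))
          \<le> ennreal C * Lr_norm p (\<lambda>x. ennreal (cmod (gauss s x)))
                      * Lr_norm q (\<lambda>x. ennreal (cmod (gauss t x)))" if "s > 0" "t > 0" for s t
    using that by (intro all schwartz_gauss) auto
  have "p \<ge> 2"
    using exponent_ge_2[of p q r C] bound C assms(1-3) by simp
  moreover have "q \<ge> 2"
    using exponent_ge_2[of q p r C] bound[of 1] C assms(1-3)
    by (simp add: square_function_gauss_swap[of _ 1] mult_ac)
  ultimately show ?thesis by simp
qed

end
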